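(* Let $\mathcal{M}$ be a minimal criminal. Then: (1) $\mathcal{M}$ is strongly connected. (2) For each $u\in V(\mathcal{M})$, $A_s(u)\in\{1,2\}$. (3) For every edge $e=(u,v)\in E(\mathcal{M})$, for all but at most one element $w$ of $\{v\}\cup N_1(v)$ there is a directed path of length 1 or 2 from $u$ to $w$ in $\mathcal{M}$ that does not use the edge $e$. (4) Every edge of $\mathcal{M}$ is the base of a transitive triangle or a base of a 2-directed diamond. (5) If $e=(u,v)\in E(\mathcal{M})$ and $|N_1(u)|\le |N_1(v)|$, then $e$ is the base of at least $|N_1(v)|-|N_1(u)|+1$ transitive triangles and a base of at least $|N_1(v)|-|N_1(u)|+1$ 2-directed diamonds. (6) For every vertex $u\in V(\mathcal{M})$ there exists $v\in N_{-1}(u)$ with $A_s(v)=1$. (7) There is a directed cycle in $\mathcal{M}$ all of whose vertices $w$ satisfy $A_s(w)=1$.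
   Context: All digraphs are finite, nonempty, with no loops, no multiple edges and no digons (if $(u,v)\in E$ then $(v,u)\notin E$). For a vertex $u$ and positive integer $i$, $N_i(u)=\{v : \mathrm{dist}(u,v)=i\}$ and $N_{-i}(u)=\{v:\mathrm{dist}(v,u)=i\}$, where $\mathrm{dist}(u,v)$ is the length of a shortest directed path from $u$ to $v$ ($\infty$ if none). A vertex $u$ is satisfactory if $|N_1(u)|\le|N_2(u)|$; the anti-satisfaction of $u$ is $A_s(u)=|N_1(u)|-|N_2(u)|$. Let $\mathcal{A}$ be the set of such digraphs having no satisfactory vertex, $\mathcal{A}'$ the set of members of $\mathcal{A}$ with the minimum number of edges among members of $\mathcal{A}$, and $\mathcal{A}''$ the set of members of $\mathcal{A}'$ with the minimum number of vertices among members of $\mathcal{A}'$. A minimal criminal is an element of $\mathcal{A}''$. A transitive triangle with base $(u,v)$ is a triple $u,v,w$ with $(u,v),(u,w),(v,w)$ edges; so the number of transitive triangles with base $(u,v)$ is $|N_1(u)\cap N_1(v)|$, and $(u,v)$ is the base of a transitive triangle iff $N_1(u)\cap N_1(v)\neq\emptyset$. For distinct vertices $t,u,v,w$ with $(t,u),(u,w),(t,v),(v,w)$ all edges, the edge set $\{(t,u),(u,w),(t,v),(v,w)\}$ is a 2-directed diamond, whose bases are the edges $(t,u)$ and $(t,v)$. *)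

theory Defs
  imports "Graph_Theory.Graph_Theory" "HOL-Library.Extended_Nat"
begin

text \<open>
  Arcs are ordered pairs of vertices, so multiple edges are excluded by the representation.
\<close>

definition oriented_digraph :: "'a pair_pre_digraph \<Rightarrow> bool" where
  "oriented_digraph G \<longleftrightarrow>
     pair_digraph G \<and> pverts G \<noteq> {} \<and>
     (\<forall>u v. (u, v) \<in> parcs G \<longrightarrow> (v, u) \<notin> parcs G)"

definition distance :: "'a pair_pre_digraph \<Rightarrow> 'a \<Rightarrow> 'a \<Rightarrow> enat" where
  "distance G u v = (INF p \<in> {p. pre_digraph.apath (with_proj G) u p v}. enat (length p))"

definition out_nbrs :: "'a pair_pre_digraph \<Rightarrow> nat \<Rightarrow> 'a \<Rightarrow> 'a set" where
  "out_nbrs G i u = {v \<in> pverts G. distance G u v = enat i}"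

definition in_nbrs :: "'a pair_pre_digraph \<Rightarrow> nat \<Rightarrow> 'a \<Rightarrow> 'a set" where
  "in_nbrs G i u = {v \<in> pverts G. distance G v u = enat i}"

definition satisfactory :: "'a pair_pre_digraph \<Rightarrow> 'a \<Rightarrow> bool" where
  "satisfactory G u \<longleftrightarrow> card (out_nbrs G 1 u) \<le> card (out_nbrs G 2 u)"

definition anti_satisfaction :: "'a pair_pre_digraph \<Rightarrow> 'a \<Rightarrow> int" where
  "anti_satisfaction G u = int (card (out_nbrs G 1 u)) - int (card (out_nbrs G 2 u))"

definition criminals :: "'a pair_pre_digraph set" where
  "criminals = {G. oriented_digraph G \<and> (\<forall>u \<in> pverts G. \<not> satisfactory G u)}"

text \<open>
  Minimality is meant among all finite digraphs, whatever their vertices are. Every finite digraph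
  is isomorphic to one whose vertices are natural numbers, so the competitors range over digraphs
  on \<^typ>\<open>nat\<close>. Letting them range over digraphs on the vertex type \<^typ>\<open>'a\<close> would be a weaker
  condition when \<^typ>\<open>'a\<close> is finite.
\<close>

definition edge_minimal_criminals :: "'a pair_pre_digraph set" where
  "edge_minimal_criminals =
     {G \<in> criminals. \<forall>H \<in> (criminals :: nat pair_pre_digraph set).
        card (parcs G) \<le> card (parcs H)}"

definition minimal_criminals :: "'a pair_pre_digraph set" where
  "minimal_criminals =
     {G \<in> edge_minimal_criminals. \<forall>H \<in> (edge_minimal_criminals :: nat pair_pre_digraph set).
        card (pverts G) \<le> card (pverts H)}"

definition transitive_triangles :: "'a pair_pre_digraph \<Rightarrow> 'a \<times> 'a \<Rightarrow> ('a \<times> 'a \<times> 'a) set" where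
  "transitive_triangles G e =
     {(u, v, w). e = (u, v) \<and> (u, v) \<in> parcs G \<and> (u, w) \<in> parcs G \<and> (v, w) \<in> parcs G}"

text \<open>A diamond is its set of four edges, so exchanging the two middle vertices does not give
  another diamond.\<close>

definition two_directed_diamonds :: "'a pair_pre_digraph \<Rightarrow> 'a \<times> 'a \<Rightarrow> ('a \<times> 'a) set set" where
  "two_directed_diamonds G e =
     {{(t, u), (u, w), (t, v), (v, w)} | t u v w.
        distinct [t, u, v, w] \<and> {(t, u), (u, w), (t, v), (v, w)} \<subseteq> parcs G \<and>
        e \<in> {(t, u), (t, v)}}"

end

theory Submission
  imports Defs
begin

text \<open>
  Deleting the arc \<open>(u, v)\<close> leaves the first neighbourhood of every vertex other than \<open>u\<close> unchanged
  and does not enlarge its second neighbourhood. By minimality some vertex becomes satisfactory, so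
  it is \<open>u\<close>. Its second neighbourhood gains at most \<open>v\<close>, and loses exactly the out-neighbours of
  \<open>v\<close> that \<open>u\<close> reaches in at most two steps only through \<open>v\<close>. Hence at most one vertex is lost, and
  none is unless \<open>v\<close> is gained. This gives parts (2) to (5). Deleting a vertex \<open>u\<close> instead makes
  some in-neighbour \<open>t\<close> of \<open>u\<close> satisfactory, and since the second neighbourhood of \<open>t\<close> gains
  nothing, \<open>A\<^sub>s(t) = 1\<close>. Going backwards along such in-neighbours yields the cycle.
\<close>

section \<open>Distances one and two in terms of arcs\<close>

text \<open>The arc-level form of \<open>out_nbrs G 2\<close>: taking away \<open>u\<close> and its
  out-neighbours takes away distances 0 and 1. Later arguments compare arc sets instead of
  paths.\<close>

definition second_nbrs :: "'a rel \<Rightarrow> 'a \<Rightarrow> 'a set" where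
  "second_nbrs E u = E `` (E `` {u}) - insert u (E `` {u})"

lemma distance_eq_enat_iff:
  "distance G u v = enat n \<longleftrightarrow>
     (\<exists>p. pre_digraph.apath (with_proj G) u p v \<and> length p = n) \<and>
     (\<forall>p. pre_digraph.apath (with_proj G) u p v \<longrightarrow> n \<le> length p)"
  (is "?L \<longleftrightarrow> ?R")
proof -
  define A where "A = (\<lambda>p. enat (length p)) ` {p. pre_digraph.apath (with_proj G) u p v}"
  have d: "distance G u v = Inf A" by (simp add: distance_def A_def)
  have "Inf A = enat n \<longleftrightarrow> enat n \<in> A \<and> (\<forall>x \<in> A. enat n \<le> x)"
  proof
    assume *: "Inf A = enat n"
    \<comment> \<open>The infimum of the empty set is infinite, so a finite value forces
      \<open>A\<close> to be nonempty; a nonempty set of \<open>enat\<close> contains its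
      infimum.\<close>
    then obtain a where "a \<in> A" by (auto simp: Inf_enat_def split: if_splits)
    then have "Inf A \<in> A" by (auto simp: Inf_enat_def intro: LeastI)
    with * show "enat n \<in> A \<and> (\<forall>x \<in> A. enat n \<le> x)" by (metis Inf_lower)
  next
    assume "enat n \<in> A \<and> (\<forall>x \<in> A. enat n \<le> x)"
    then show "Inf A = enat n" by (intro antisym Inf_lower Inf_greatest) auto
  qed
  then show ?thesis unfolding d by (auto simp: A_def)
qed

lemma (in pair_wf_digraph) apath_length_0: "apath u p v \<and> length p = 0 \<longleftrightarrow> p = [] \<and> u = v \<and> u \<in> pverts G"
  by (auto simp: apath_Nil_iff)

lemma (in pair_loopfree_digraph) apath_length_1:
  "apath u p v \<and> length p = 1 \<longleftrightarrow> p = [(u, v)] \<and> (u, v) \<in> parcs G"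
  by (cases p) (auto simp: apath_def awalk_def dest: no_loops' in_arcsD1)

lemma (in pair_loopfree_digraph) apath_length_2:
  "apath u p v \<and> length p = 2 \<longleftrightarrow>
     (\<exists>s. p = [(u, s), (s, v)] \<and> u \<noteq> v \<and> (u, s) \<in> parcs G \<and> (s, v) \<in> parcs G)"
proof
  assume *: "apath u p v \<and> length p = 2"
  then obtain a b where "p = [a, b]" by (auto simp: length_Suc_conv numeral_2_eq_2)
  with * show "\<exists>s. p = [(u, s), (s, v)] \<and> u \<noteq> v \<and> (u, s) \<in> parcs G \<and> (s, v) \<in> parcs G"
    by (cases a, cases b) (auto simp: apath_def awalk_def)
qed (auto simp: apath_def awalk_def dest: no_loops' in_arcsD1)

context pair_loopfree_digraph
begin

lemma distance_eq_1_iff: "distance G u v = enat 1 \<longleftrightarrow> (u, v) \<in> parcs G"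
proof -
  have "(\<forall>p. apath u p v \<longrightarrow> 1 \<le> length p)" if "(u, v) \<in> parcs G"
    using no_loops'[OF that] by (auto simp: apath_Nil_iff Suc_le_eq)
  then show ?thesis unfolding distance_eq_enat_iff using apath_length_1[of u _ v] by blast
qed

lemma distance_eq_2_iff: "distance G u v = enat 2 \<longleftrightarrow> v \<in> second_nbrs (parcs G) u"
proof -
  have "(\<forall>p. apath u p v \<longrightarrow> 2 \<le> length p) \<longleftrightarrow>
      \<not> (\<exists>p. apath u p v \<and> length p = 0) \<and> \<not> (\<exists>p. apath u p v \<and> length p = 1)"
    by (auto simp: less_2_cases_iff simp flip: not_less)
  also have "\<dots> \<longleftrightarrow> \<not> (u = v \<and> u \<in> pverts G) \<and> (u, v) \<notin> parcs G"
    unfolding apath_length_0 apath_length_1 by simp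
  finally show ?thesis
    unfolding distance_eq_enat_iff apath_length_2 second_nbrs_def by (auto dest: in_arcsD1)
qed

lemma out_nbrs_1_eq: "out_nbrs G 1 u = parcs G `` {u}"
  unfolding out_nbrs_def distance_eq_1_iff by (auto dest: in_arcsD2)

lemma in_nbrs_1_eq: "in_nbrs G 1 u = {v. (v, u) \<in> parcs G}"
  unfolding in_nbrs_def distance_eq_1_iff by (auto dest: in_arcsD1)

lemma out_nbrs_2_eq: "out_nbrs G 2 u = second_nbrs (parcs G) u"
  unfolding out_nbrs_def distance_eq_2_iff by (auto simp: second_nbrs_def dest: in_arcsD2)

end

section \<open>Criminals in terms of arcs, and relabelling by natural numbers\<close>

text \<open>A loop is its own reversal, so the digon condition excludes it; the arcs are finite in
  number as part of a finite product.\<close>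

lemma oriented_digraph_iff:
  "oriented_digraph G \<longleftrightarrow>
     finite (pverts G) \<and> pverts G \<noteq> {} \<and> parcs G \<subseteq> pverts G \<times> pverts G \<and>
     (\<forall>u v. (u, v) \<in> parcs G \<longrightarrow> (v, u) \<notin> parcs G)" (is "?L \<longleftrightarrow> ?R")
proof
  assume ?L
  then interpret pair_digraph G by (simp add: oriented_digraph_def)
  from \<open>?L\<close> show ?R
    by (auto simp: oriented_digraph_def pair_finite_verts dest: in_arcsD1 in_arcsD2)
next
  assume R: ?R
  then have irrefl: "(x, x) \<notin> parcs G" for x by blast
  have "pair_digraph G"
  proof
    show "finite (parcs G)" by (rule finite_subset[of _ "pverts G \<times> pverts G"]) (use R in auto)
  qed (use R irrefl in auto)
  with R show ?L by (simp add: oriented_digraph_def)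
qed

text \<open>Every competitor constructed below is recognised as a criminal through this path-free
  form.\<close>

lemma criminals_iff:
  "G \<in> criminals \<longleftrightarrow>
     finite (pverts G) \<and> pverts G \<noteq> {} \<and> parcs G \<subseteq> pverts G \<times> pverts G \<and>
     (\<forall>u v. (u, v) \<in> parcs G \<longrightarrow> (v, u) \<notin> parcs G) \<and>
     (\<forall>u \<in> pverts G. card (second_nbrs (parcs G) u) < card (parcs G `` {u}))"
proof (cases "oriented_digraph G")
  case True
  then interpret pair_digraph G by (simp add: oriented_digraph_def)
  show ?thesis using True unfolding oriented_digraph_iff
    by (auto simp: criminals_def satisfactory_def out_nbrs_1_eq[unfolded One_nat_def]
        out_nbrs_2_eq True not_le)
next
  case False
  then show ?thesis by (auto simp: criminals_def oriented_digraph_iff)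
qed

lemma second_nbrs_map_prod:
  assumes inj: "inj_on f V" and E: "E \<subseteq> V \<times> V" and u: "u \<in> V"
  shows "(map_prod f f ` E) `` {f u} = f ` (E `` {u})"
    and "second_nbrs (map_prod f f ` E) (f u) = f ` second_nbrs E u"
proof -
  have img: "(map_prod f f ` E) `` (f ` A) = f ` (E `` A)" if "A \<subseteq> V" for A
  proof -
    have "x \<in> A" if "(x, y) \<in> E" "f x = f a" "a \<in> A" for x y a
    proof -
      have "x = a" using that E \<open>A \<subseteq> V\<close> by (intro inj_onD[OF inj]) auto
      then show ?thesis using that by simp
    qed
    then have "(map_prod f f ` E) `` (f ` A) \<subseteq> f ` (E `` A)"
      by (auto intro!: imageI) (metis ImageI)
    moreover have "f ` (E `` A) \<subseteq> (map_prod f f ` E) `` (f ` A)" by auto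
    ultimately show ?thesis by (rule equalityI)
  qed
  show 1: "(map_prod f f ` E) `` {f u} = f ` (E `` {u})" using img[of "{u}"] u by simp
  have sub: "E `` {u} \<subseteq> V" "E `` (E `` {u}) \<subseteq> V" "insert u (E `` {u}) \<subseteq> V" using E u by auto
  show "second_nbrs (map_prod f f ` E) (f u) = f ` second_nbrs E u"
    unfolding second_nbrs_def 1 img[OF sub(1)]
    using inj_on_image_set_diff[OF inj _ sub(3), of "E `` (E `` {u})"] sub by auto
qed

text \<open>Minimality is tested against digraphs on \<open>nat\<close>, while the competitors built
  from a minimal criminal live on \<open>'a\<close>. An injective relabelling of the finite vertex
  set bridges the two.\<close>

lemma criminal_on_nat:
  assumes "G \<in> criminals"
  obtains H :: "nat pair_pre_digraph"
  where "H \<in> criminals" "card (pverts H) = card (pverts G)" "card (parcs H) = card (parcs G)"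
proof -
  let ?V = "pverts G" and ?E = "parcs G"
  have fin: "finite ?V" and ne: "?V \<noteq> {}" and E: "?E \<subseteq> ?V \<times> ?V"
    and anti: "\<And>u v. (u, v) \<in> ?E \<Longrightarrow> (v, u) \<notin> ?E"
    and crim: "\<And>u. u \<in> ?V \<Longrightarrow> card (second_nbrs ?E u) < card (?E `` {u})"
    using assms by (auto simp: criminals_iff)
  obtain f :: "'a \<Rightarrow> nat" where inj: "inj_on f ?V" using finite_imp_inj_to_nat_seg[OF fin] by blast
  have injE: "inj_on (map_prod f f) ?E"
    using inj_on_subset[OF map_prod_inj_on[OF inj inj] E] .
  let ?H = "\<lparr>pverts = f ` ?V, parcs = map_prod f f ` ?E\<rparr>"
  have "card (second_nbrs (parcs ?H) (f u)) < card (parcs ?H `` {f u})" if "u \<in> ?V" for u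
  proof -
    have "second_nbrs ?E u \<subseteq> ?V" "?E `` {u} \<subseteq> ?V" using E by (auto simp: second_nbrs_def)
    then have "inj_on f (second_nbrs ?E u)" "inj_on f (?E `` {u})" using inj inj_on_subset by blast+
    then show ?thesis
      using crim[OF that] by (simp add: second_nbrs_map_prod[OF inj E that] card_image)
  qed
  moreover have "(b, a) \<notin> parcs ?H" if "(a, b) \<in> parcs ?H" for a b
  proof
    assume "(b, a) \<in> parcs ?H"
    with that obtain x y z w where *: "(x, y) \<in> ?E" "(z, w) \<in> ?E"
      "a = f x" "b = f y" "b = f z" "a = f w" by auto
    then have "x = w" "y = z" using E inj by (auto dest: inj_onD)
    with * anti show False by blast
  qed
  ultimately have "?H \<in> criminals" using fin ne E unfolding criminals_iff by auto
  with inj injE show thesis by (intro that[of ?H]) (auto simp: card_image)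
qed

section \<open>Minimality, out-degrees and strong connectivity\<close>

locale minimal_criminal =
  fixes M :: "'a pair_pre_digraph"
  assumes minimal: "M \<in> minimal_criminals"
begin

abbreviation "V \<equiv> pverts M"
abbreviation "E \<equiv> parcs M"

lemma criminal: "M \<in> criminals"
  using minimal by (auto simp: minimal_criminals_def edge_minimal_criminals_def)

lemma finite_V: "finite V" and V_nonempty: "V \<noteq> {}" and E_subset: "E \<subseteq> V \<times> V"
  and no_digon: "(u, v) \<in> E \<Longrightarrow> (v, u) \<notin> E"
  and second_less_first: "u \<in> V \<Longrightarrow> card (second_nbrs E u) < card (E `` {u})"
  using criminal by (auto simp: criminals_iff)

sublocale pair_digraph M
  using criminal by (simp add: criminals_def oriented_digraph_def)

lemma finite_out: "finite (E `` A)" and finite_second_nbrs: "finite (second_nbrs E u)"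
  using pair_finite_arcs by (simp_all add: second_nbrs_def finite_Image)

lemma card_arcs_le:
  assumes "H \<in> criminals"
  shows "card E \<le> card (parcs H)"
proof -
  obtain H' :: "nat pair_pre_digraph" where "H' \<in> criminals" "card (parcs H') = card (parcs H)"
    using criminal_on_nat[OF assms] by metis
  with minimal show ?thesis by (auto simp: minimal_criminals_def edge_minimal_criminals_def)
qed

text \<open>Having no more arcs than \<open>M\<close>, the copy of \<open>H\<close> on
  \<open>nat\<close> is itself edge-minimal, so it takes part in the comparison of vertex
  numbers.\<close>

lemma card_verts_le:
  assumes "H \<in> criminals" "card (parcs H) \<le> card E"
  shows "card V \<le> card (pverts H)"
proof -
  obtain H' :: "nat pair_pre_digraph" where H': "H' \<in> criminals"
      "card (pverts H') = card (pverts H)" "card (parcs H') = card (parcs H)"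
    using criminal_on_nat[OF assms(1)] by metis
  with assms(2) have "H' \<in> edge_minimal_criminals"
    using minimal by (force simp: minimal_criminals_def edge_minimal_criminals_def)
  with minimal H'(2) show ?thesis by (auto simp: minimal_criminals_def)
qed

lemma out_nbr_exists:
  assumes "u \<in> V"
  obtains v where "(u, v) \<in> E"
  using second_less_first[OF assms] by (cases "E `` {u} = {}") auto

text \<open>If \<open>v\<close> were the only out-neighbour of \<open>u\<close>, any out-neighbour
  of \<open>v\<close> would be a second neighbour of \<open>u\<close>, since digons and loops are
  excluded. Then \<open>u\<close> would be satisfactory.\<close>

lemma out_degree_ge_2:
  assumes "u \<in> V"
  shows "2 \<le> card (E `` {u})"
proof (rule ccontr)
  assume "\<not> 2 \<le> card (E `` {u})"
  with second_less_first[OF assms] have "card (E `` {u}) = 1" and 0: "card (second_nbrs E u) = 0"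
    by linarith+
  then obtain v where v: "E `` {u} = {v}" by (auto simp: card_1_singleton_iff)
  then have uv: "(u, v) \<in> E" by auto
  then obtain w where "(v, w) \<in> E" using in_arcsD2 out_nbr_exists by metis
  with uv v have "w \<in> second_nbrs E u" using no_digon no_loops' by (auto simp: second_nbrs_def)
  with 0 finite_second_nbrs show False by auto
qed

text \<open>A vertex set closed under out-neighbours induces a criminal, because it preserves the first
  and second neighbourhoods of its vertices.\<close>

lemma strongly_connected_M: "strongly_connected (with_proj M)"
proof (rule strongly_connectedI)
  show "verts (with_proj M) \<noteq> {}" using V_nonempty by simp
next
  fix u v assume "u \<in> verts (with_proj M)" "v \<in> verts (with_proj M)"
  then have u: "u \<in> V" and v: "v \<in> V" by simp_all
  define R where "R = {w. u \<rightarrow>\<^sup>*\<^bsub>with_proj M\<^esub> w}"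
  have uR: "u \<in> R" using u by (auto simp: R_def)
  have RV: "R \<subseteq> V" using reachable_in_verts(2) by (auto simp: R_def)
  have closed: "y \<in> R" if "x \<in> R" "(x, y) \<in> E" for x y
    using that reachable_adj_trans[of u x y] by (auto simp: R_def)
  let ?H = "\<lparr>pverts = R, parcs = E \<inter> R \<times> R\<rparr>"
  have first: "(E \<inter> R \<times> R) `` A = E `` A" if "A \<subseteq> R" for A using that closed by blast
  have "card (second_nbrs (E \<inter> R \<times> R) x) < card ((E \<inter> R \<times> R) `` {x})" if x: "x \<in> R" for x
  proof -
    have "E `` {x} \<subseteq> R" using x closed by blast
    with first x have eq: "(E \<inter> R \<times> R) `` {x} = E `` {x}"
       "second_nbrs (E \<inter> R \<times> R) x = second_nbrs E x" by (simp_all add: second_nbrs_def)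
    show ?thesis unfolding eq using second_less_first x RV by blast
  qed
  moreover have "finite R" using RV finite_V finite_subset by blast
  ultimately have "?H \<in> criminals" unfolding criminals_iff using uR no_digon by auto
  moreover have "card (parcs ?H) \<le> card E" using pair_finite_arcs by (auto intro: card_mono)
  \<comment> \<open>The one appeal to vertex minimality: the induced digraph has no more arcs than
    \<open>M\<close>, so it cannot have fewer vertices.\<close>
  ultimately have "card V \<le> card R" using card_verts_le by fastforce
  with RV finite_V have "R = V" by (simp add: card_seteq)
  with v show "u \<rightarrow>\<^sup>*\<^bsub>with_proj M\<^esub> v" by (auto simp: R_def)
qed

section \<open>Deleting an arc or a vertex\<close>

text \<open>The \<open>Suc\<close> accounts for the out-neighbour that \<open>u\<close> has lost:
  the inequality says that \<open>u\<close> is satisfactory after the deletion.\<close>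

lemma deleted_arc_satisfactory:
  assumes e: "(u, v) \<in> E"
  shows "card (E `` {u}) \<le> Suc (card (second_nbrs (E - {(u, v)}) u))"
proof (rule ccontr)
  assume neg: "\<not> ?thesis"
  let ?E = "E - {(u, v)}"
  let ?H = "\<lparr>pverts = V, parcs = ?E\<rparr>"
  have "card (second_nbrs ?E t) < card (?E `` {t})" if "t \<in> V" for t
  proof (cases "t = u")
    case True
    have "?E `` {u} = E `` {u} - {v}" by auto
    then have "card (?E `` {u}) = card (E `` {u}) - 1" using e by (simp add: finite_out)
    with neg True show ?thesis by simp
  next
    case False
    then have 1: "?E `` {t} = E `` {t}" by auto
    then have "second_nbrs ?E t \<subseteq> second_nbrs E t" by (auto simp: second_nbrs_def)
    then have "card (second_nbrs ?E t) \<le> card (second_nbrs E t)"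
      using finite_second_nbrs card_mono by blast
    with 1 second_less_first[OF that] show ?thesis by simp
  qed
  then have "?H \<in> criminals"
    unfolding criminals_iff using finite_V V_nonempty E_subset no_digon by auto
  from card_arcs_le[OF this] show False
    using card_Diff1_less[OF pair_finite_arcs e] by simp
qed

text \<open>The inequality concerns neighbourhoods in \<open>M\<close>, not in the smaller digraph:
  an in-neighbour of \<open>u\<close> loses one out-neighbour and gains no second neighbour. The
  other vertices keep their out-neighbours and so stay unsatisfactory.\<close>

lemma deleted_vertex_satisfactory:
  assumes u: "u \<in> V"
  obtains t where "(t, u) \<in> E" "card (E `` {t}) \<le> Suc (card (second_nbrs E t))"
proof (rule ccontr)
  assume "\<not> thesis"
  with that have neg: "\<not> card (E `` {t}) \<le> Suc (card (second_nbrs E t))" if "(t, u) \<in> E" for t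
    using \<open>(t, u) \<in> E\<close> by blast
  let ?E = "E \<inter> (V - {u}) \<times> (V - {u})"
  let ?H = "\<lparr>pverts = V - {u}, parcs = ?E\<rparr>"
  \<comment> \<open>This arc serves twice: \<open>w\<close> remains as a vertex after the deletion,
    and the arc itself disappears, so the arc count drops strictly.\<close>
  obtain w where w: "(u, w) \<in> E" using out_nbr_exists[OF u] .
  have "card (second_nbrs ?E t) < card (?E `` {t})" if "t \<in> V - {u}" for t
  proof -
    have 1: "?E `` {t} = E `` {t} - {u}" using that E_subset by auto
    \<comment> \<open>Although \<open>u\<close> leaves the first neighbourhood of \<open>t\<close>,
      it does not reappear in the second, because no remaining arc ends in \<open>u\<close>.\<close>
    then have "second_nbrs ?E t \<subseteq> second_nbrs E t" by (auto simp: second_nbrs_def)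
    then have 2: "card (second_nbrs ?E t) \<le> card (second_nbrs E t)"
      using finite_second_nbrs card_mono by blast
    show ?thesis
    proof (cases "(t, u) \<in> E")
      case True
      then have "\<not> card (E `` {t}) \<le> Suc (card (second_nbrs E t))" by (rule neg)
      moreover have "card (?E `` {t}) = card (E `` {t}) - 1"
        unfolding 1 using True by (simp add: finite_out)
      ultimately show ?thesis using 2 by linarith
    next
      case False
      then have "?E `` {t} = E `` {t}" unfolding 1 by auto
      then show ?thesis using 2 second_less_first[of t] that by simp
    qed
  qed
  moreover have "w \<in> V - {u}" using w in_arcsD2 no_loops' by blast
  ultimately have "?H \<in> criminals"
    unfolding criminals_iff using finite_V no_digon by auto
  from card_arcs_le[OF this] have "card E \<le> card ?E" by simp
  moreover have "?E \<subset> E" using w by blast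
  then have "card ?E < card E" by (rule psubset_card_mono[OF pair_finite_arcs])
  ultimately show False by linarith
qed

section \<open>Second neighbours lost by deleting an arc\<close>

lemma anti_satisfaction_eq:
  "anti_satisfaction M u = int (card (E `` {u})) - int (card (second_nbrs E u))"
  by (simp add: anti_satisfaction_def out_nbrs_1_eq[unfolded One_nat_def] out_nbrs_2_eq)

definition lost :: "'a \<Rightarrow> 'a \<Rightarrow> 'a set" where
  "lost u v = {w. (v, w) \<in> E \<and> (u, w) \<notin> E \<and> \<not> (\<exists>s. s \<noteq> v \<and> (u, s) \<in> E \<and> (s, w) \<in> E)}"

text \<open>Only \<open>v\<close> is dropped as an out-neighbour of \<open>u\<close>, so only
  \<open>v\<close> can enter at distance two, and it does so when a two-step path to it exists; such
  a path does not use the deleted arc.\<close>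

lemma second_nbrs_delete_arc:
  assumes e: "(u, v) \<in> E"
  shows "second_nbrs (E - {(u, v)}) u =
    (second_nbrs E u - lost u v) \<union> (if \<exists>s. (u, s) \<in> E \<and> (s, v) \<in> E then {v} else {})"
  using e no_digon no_loops' by (auto simp: second_nbrs_def lost_def)

lemma lost_subset: "(u, v) \<in> E \<Longrightarrow> lost u v \<subseteq> second_nbrs E u"
  using no_digon by (auto simp: second_nbrs_def lost_def)

text \<open>This is satisfaction of \<open>u\<close> after the deletion, arranged without
  subtraction. Combined with |N_2(u)| < |N_1(u)| in \<open>M\<close>, it bounds
  \<open>lost u v\<close> by the number of vertices gained; dropping the lost term gives
  anti-satisfaction at most 2.\<close>

lemma card_lost_le:
  assumes e: "(u, v) \<in> E"
  shows "card (E `` {u}) + card (lost u v) \<le>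
    Suc (card (second_nbrs E u)) + (if \<exists>s. (u, s) \<in> E \<and> (s, v) \<in> E then 1 else 0)"
proof -
  let ?X = "if \<exists>s. (u, s) \<in> E \<and> (s, v) \<in> E then {v} else {}"
  have "card (second_nbrs (E - {(u, v)}) u) \<le> card (second_nbrs E u - lost u v) + card ?X"
    unfolding second_nbrs_delete_arc[OF e] by (rule card_Un_le)
  also have "card (second_nbrs E u - lost u v) = card (second_nbrs E u) - card (lost u v)"
    using lost_subset[OF e] finite_second_nbrs by (meson card_Diff_subset finite_subset)
  finally have "card (second_nbrs (E - {(u, v)}) u) + card (lost u v) \<le> card (second_nbrs E u) + card ?X"
    using card_mono[OF finite_second_nbrs lost_subset[OF e]] by linarith
  with deleted_arc_satisfactory[OF e] show ?thesis by (auto split: if_splits)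
qed

lemma card_lost:
  assumes e: "(u, v) \<in> E"
  shows "card (lost u v) \<le> (if \<exists>s. (u, s) \<in> E \<and> (s, v) \<in> E then 1 else 0)"
  using card_lost_le[OF e] second_less_first[OF in_arcsD1[OF e]] by linarith

lemma finite_lost: "(u, v) \<in> E \<Longrightarrow> finite (lost u v)"
  using lost_subset finite_second_nbrs finite_subset by blast

lemma anti_satisfaction_1_or_2:
  assumes "u \<in> V"
  shows "anti_satisfaction M u \<in> {1, 2}"
proof -
  obtain v where "(u, v) \<in> E" using out_nbr_exists[OF assms] .
  from card_lost_le[OF this] have "card (E `` {u}) \<le> card (second_nbrs E u) + 2"
    by (auto split: if_splits)
  with second_less_first[OF assms] show ?thesis by (auto simp: anti_satisfaction_eq)
qed

text \<open>If there is a two-step path from \<open>u\<close> to \<open>v\<close>, then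
  \<open>v\<close> is reached and the exception is the lost vertex, if any. Otherwise nothing is
  lost and the exception is \<open>v\<close>.\<close>

lemma short_paths_avoiding_arc:
  assumes e: "(u, v) \<in> E"
  shows "\<exists>x. \<forall>w \<in> ({v} \<union> E `` {v}) - {x}. \<exists>p. apath u p w \<and> length p \<in> {1, 2} \<and> (u, v) \<notin> set p"
proof -
  have one: "\<exists>p. apath u p w \<and> length p \<in> {1, 2} \<and> (u, v) \<notin> set p" if "(u, w) \<in> E" "w \<noteq> v" for w
  proof -
    have "apath u [(u, w)] w" using apath_length_1[of u "[(u, w)]" w] that by blast
    with that show ?thesis by (intro exI[of _ "[(u, w)]"]) simp
  qed
  \<comment> \<open>An \<open>apath\<close> repeats no vertex, whence \<open>w \<noteq> u\<close>;
    for out-neighbours of \<open>v\<close> this follows from the absence of digons.\<close>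
  have two: "\<exists>p. apath u p w \<and> length p \<in> {1, 2} \<and> (u, v) \<notin> set p"
    if "(u, s) \<in> E" "(s, w) \<in> E" "s \<noteq> v" "w \<noteq> u" for s w
  proof -
    have "apath u [(u, s), (s, w)] w" using apath_length_2[of u "[(u, s), (s, w)]" w] that by blast
    with that no_loops'[of u s] show ?thesis by (intro exI[of _ "[(u, s), (s, w)]"]) simp
  qed
  have good: "\<exists>p. apath u p w \<and> length p \<in> {1, 2} \<and> (u, v) \<notin> set p"
    if "(v, w) \<in> E" "w \<notin> lost u v" for w
  proof -
    have "w \<noteq> u" "w \<noteq> v" using that e no_digon no_loops' by auto
    moreover have "(u, w) \<in> E \<or> (\<exists>s. s \<noteq> v \<and> (u, s) \<in> E \<and> (s, w) \<in> E)"
      using that by (auto simp: lost_def)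
    ultimately show ?thesis using one[of w] two[of _ w] by blast
  qed
  show ?thesis
  proof (cases "\<exists>s. (u, s) \<in> E \<and> (s, v) \<in> E")
    case True
    with card_lost[OF e] have "card (lost u v) \<le> Suc 0" by simp
    \<comment> \<open>An inclusion is enough: when nothing is lost, \<open>x\<close> is
      arbitrary.\<close>
    then obtain x where x: "lost u v \<subseteq> {x}"
      using card_le_Suc0_iff_eq[OF finite_lost[OF e]] by (cases "lost u v = {}") auto
    from True obtain s where "(u, s) \<in> E" "(s, v) \<in> E" by blast
    then have "\<exists>p. apath u p v \<and> length p \<in> {1, 2} \<and> (u, v) \<notin> set p"
      using two[of s v] e no_loops' by blast
    with x good show ?thesis by (intro exI[of _ x]) auto
  next
    case False
    with card_lost[OF e] finite_lost[OF e] have "lost u v = {}" by auto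
    with good show ?thesis by (intro exI[of _ v]) auto
  qed
qed

section \<open>Counting transitive triangles and diamonds\<close>

lemma transitive_triangles_eq:
  assumes "(u, v) \<in> E"
  shows "transitive_triangles M (u, v) = (\<lambda>w. (u, v, w)) ` (E `` {u} \<inter> E `` {v})"
  using assms by (auto simp: transitive_triangles_def)

lemma card_transitive_triangles:
  assumes "(u, v) \<in> E"
  shows "card (transitive_triangles M (u, v)) = card (E `` {u} \<inter> E `` {v})"
  unfolding transitive_triangles_eq[OF assms] by (rule card_image) (auto simp: inj_on_def)

lemma two_directed_diamondI:
  assumes "(u, v) \<in> E" "(v, w) \<in> E" "(u, s) \<in> E" "(s, w) \<in> E" "s \<noteq> v"
  shows "{(u, v), (v, w), (u, s), (s, w)} \<in> two_directed_diamonds M (u, v)"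
proof -
  have "distinct [u, v, s, w]" using assms no_digon no_loops' by auto
  with assms show ?thesis unfolding two_directed_diamonds_def by blast
qed

text \<open>An out-neighbour \<open>w\<close> of \<open>v\<close> that is neither an out-neighbour
  of \<open>u\<close> nor lost has a second route from \<open>u\<close> through some
  \<open>s \<noteq> v\<close>. One such route is chosen for each \<open>w\<close>, and the two
  routes form a diamond.\<close>

lemma card_two_directed_diamonds:
  assumes e: "(u, v) \<in> E"
  shows "card (E `` {v} - E `` {u}) - card (lost u v) \<le> card (two_directed_diamonds M (u, v))"
proof -
  let ?W = "E `` {v} - E `` {u} - lost u v"
  have "\<forall>w \<in> ?W. \<exists>s. s \<noteq> v \<and> (u, s) \<in> E \<and> (s, w) \<in> E" by (auto simp: lost_def)
  then obtain f where f: "\<And>w. w \<in> ?W \<Longrightarrow> f w \<noteq> v \<and> (u, f w) \<in> E \<and> (f w, w) \<in> E"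
    by metis
  define D where "D w = {(u, v), (v, w), (u, f w), (f w, w)}" for w
  have "inj_on D ?W"
  proof (rule inj_onI)
    fix w w' assume w: "w \<in> ?W" "w' \<in> ?W" "D w = D w'"
    \<comment> \<open>The arc leaving \<open>v\<close> identifies \<open>w\<close>: the other arcs
      of \<open>D w'\<close> start at \<open>u\<close> or at \<open>f w'\<close>, both different
      from \<open>v\<close>.\<close>
    have "(v, w) \<in> D w" by (simp add: D_def)
    then have "(v, w) \<in> D w'" unfolding w(3) .
    with f[OF w(2)] show "w = w'" using no_loops'[OF e] by (auto simp: D_def)
  qed
  moreover have "D ` ?W \<subseteq> two_directed_diamonds M (u, v)"
    unfolding D_def using f by (intro image_subsetI two_directed_diamondI e) auto
  moreover have "finite (two_directed_diamonds M (u, v))"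
    by (rule finite_subset[of _ "Pow E"]) (auto simp: two_directed_diamonds_def pair_finite_arcs)
  ultimately have "card ?W \<le> card (two_directed_diamonds M (u, v))" by (metis card_image card_mono)
  moreover have "card (E `` {v} - E `` {u}) - card (lost u v) \<le> card ?W"
    using finite_lost[OF e] by (rule diff_card_le_card_Diff)
  ultimately show ?thesis by linarith
qed

text \<open>At least two out-neighbours of \<open>v\<close> against at most one lost vertex leave a
  \<open>w\<close> that \<open>u\<close> reaches directly, giving a triangle, or through another
  midpoint, giving a diamond.\<close>

lemma triangle_or_diamond:
  assumes e: "(u, v) \<in> E"
  shows "transitive_triangles M (u, v) \<noteq> {} \<or> two_directed_diamonds M (u, v) \<noteq> {}"
proof -
  have "card (lost u v) < card (E `` {v})"
    using card_lost[OF e] out_degree_ge_2[OF in_arcsD2[OF e]] by (auto split: if_splits)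
  then have "\<not> E `` {v} \<subseteq> lost u v" using finite_lost[OF e] card_mono leD by blast
  then obtain w where w: "(v, w) \<in> E" "w \<notin> lost u v" by blast
  then consider "(u, w) \<in> E" | s where "s \<noteq> v" "(u, s) \<in> E" "(s, w) \<in> E"
    by (auto simp: lost_def)
  then show ?thesis
  proof cases
    case 1
    with w e show ?thesis by (auto simp: transitive_triangles_eq)
  next
    case 2
    with two_directed_diamondI[OF e w(1)] show ?thesis by blast
  qed
qed

text \<open>The out-neighbours of \<open>v\<close> outside N_1(u) are second neighbours of
  \<open>u\<close>, so there are fewer than |N_1(u)| of them; the rest are common
  out-neighbours.\<close>

lemma triangle_count:
  assumes e: "(u, v) \<in> E"
  shows "card (E `` {v}) + 1 \<le> card (E `` {u}) + card (E `` {u} \<inter> E `` {v})"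
proof -
  have "E `` {v} - E `` {u} \<subseteq> second_nbrs E u" using e no_digon by (auto simp: second_nbrs_def)
  then have "card (E `` {v} - E `` {u}) \<le> card (second_nbrs E u)"
    using finite_second_nbrs card_mono by blast
  moreover have "card (E `` {v}) = card (E `` {u} \<inter> E `` {v}) + card (E `` {v} - E `` {u})"
    using card_Int_Diff[OF finite_out, of "{v}" "E `` {u}"] by (simp add: Int_commute)
  ultimately show ?thesis using second_less_first[OF in_arcsD1[OF e]] by linarith
qed

text \<open>If deleting the arc loses a vertex, there is a two-step path from \<^term>\<open>u\<close> to \<^term>\<open>v\<close>, and its
  midpoint is an out-neighbour of \<^term>\<open>u\<close> but, for lack of digons, not of \<^term>\<open>v\<close>.
  This makes up for the lost vertex.\<close>

lemma diamond_count:
  assumes e: "(u, v) \<in> E"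
  shows "card (E `` {v}) + 1 \<le> card (E `` {u}) + card (two_directed_diamonds M (u, v))"
proof -
  let ?T = "E `` {u} \<inter> E `` {v}"
  \<comment> \<open>By \<open>card_two_directed_diamonds\<close>, it suffices that the
    out-neighbours of \<open>u\<close> outside \<open>?T\<close> outnumber the lost vertices. One of
    them is \<open>v\<close>.\<close>
  have "card ?T + card (lost u v) + 1 \<le> card (E `` {u})"
  proof (cases "\<exists>s. (u, s) \<in> E \<and> (s, v) \<in> E")
    case True
    then obtain s where s: "(u, s) \<in> E" "(s, v) \<in> E" by blast
    then have "s \<noteq> v" "s \<notin> ?T" "v \<notin> ?T" using no_digon no_loops' by auto
    then have "card (insert s (insert v ?T)) = card ?T + 2" by (simp add: finite_out)
    moreover have "insert s (insert v ?T) \<subseteq> E `` {u}" using s e by auto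
    then have "card (insert s (insert v ?T)) \<le> card (E `` {u})" using finite_out card_mono by blast
    moreover have "card (lost u v) \<le> 1" using card_lost[OF e] True by simp
    ultimately show ?thesis by linarith
  next
    case False
    have "v \<notin> ?T" using no_loops' by auto
    then have "card (insert v ?T) = card ?T + 1" by (simp add: finite_out)
    moreover have "insert v ?T \<subseteq> E `` {u}" using e by auto
    then have "card (insert v ?T) \<le> card (E `` {u})" using finite_out card_mono by blast
    moreover have "card (lost u v) = 0" using card_lost[OF e] False by simp
    ultimately show ?thesis by linarith
  qed
  moreover have "card (E `` {v}) = card ?T + card (E `` {v} - E `` {u})"
    using card_Int_Diff[OF finite_out, of "{v}" "E `` {u}"] by (simp add: Int_commute)
  ultimately show ?thesis using card_two_directed_diamonds[OF e] by linarith
qed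

section \<open>In-neighbours and a cycle of anti-satisfaction one\<close>

lemma in_nbr_anti_satisfaction_1:
  assumes "u \<in> V"
  obtains v where "(v, u) \<in> E" "anti_satisfaction M v = 1"
proof -
  obtain t where t: "(t, u) \<in> E" "card (E `` {t}) \<le> Suc (card (second_nbrs E t))"
    using deleted_vertex_satisfactory[OF assms] .
  with second_less_first[OF in_arcsD1[OF t(1)]] have "anti_satisfaction M t = 1"
    by (simp add: anti_satisfaction_eq)
  with t(1) show thesis by (rule that)
qed

text \<open>Every vertex has an in-neighbour in \<open>S\<close>, so the arcs within
  \<open>S\<close> have no minimal element. A finite relation that is not well-founded is not
  acyclic, and a closed walk contains a cycle.\<close>

lemma anti_satisfaction_1_cycle:
  "\<exists>p. cycle p \<and> (\<forall>w \<in> fst ` set p \<union> snd ` set p. anti_satisfaction M w = 1)"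
proof -
  define S where "S = {u \<in> V. anti_satisfaction M u = 1}"
  let ?H = "\<lparr>pverts = S, parcs = E \<inter> S \<times> S\<rparr>"
  interpret H: pair_wf_digraph ?H by unfold_locales auto
  have pred: "\<exists>y \<in> S. (y, x) \<in> E" if x: "x \<in> V" for x
  proof -
    obtain y where "(y, x) \<in> E" "anti_satisfaction M y = 1" using in_nbr_anti_satisfaction_1[OF x] .
    then show ?thesis using in_arcsD1 by (auto simp: S_def)
  qed
  then have "S \<noteq> {}" using V_nonempty by blast
  have "\<not> wf (E \<inter> S \<times> S)"
  proof
    assume "wf (E \<inter> S \<times> S)"
    then obtain z where "z \<in> S" "\<And>y. (y, z) \<in> E \<inter> S \<times> S \<Longrightarrow> y \<notin> S"
      using \<open>S \<noteq> {}\<close> by (metis wfE_min ex_in_conv)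
    with pred[of z] show False by (auto simp: S_def)
  qed
  then have "\<not> acyclic (E \<inter> S \<times> S)" using finite_acyclic_wf pair_finite_arcs by blast
  then obtain x where "(x, x) \<in> (E \<inter> S \<times> S)\<^sup>+" by (auto simp: acyclic_def)
  then obtain q where "H.awalk x q x" "q \<noteq> []" using H.reachable1_awalk[of x x] by auto
  then have "H.closed_w q" by (auto simp: H.closed_w_def)
  then obtain p where p: "H.cycle p" using H.closed_w_imp_cycle by blast
  \<comment> \<open>The cycle was found in the digraph induced on \<open>S\<close>, which keeps all
    its vertices in \<open>S\<close>; it remains a cycle in \<open>M\<close>.\<close>
  have "subgraph (with_proj ?H) (with_proj M)"
    unfolding subgraph_def compatible_def using H.wf_digraph_axioms wf_digraph_axioms
    by (auto simp: S_def)
  then have "cycle p" using p subgraph_cycle by blast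
  moreover have "set p \<subseteq> E \<inter> S \<times> S" using p by (auto simp: H.cycle_def H.awalk_def)
  ultimately show ?thesis by (intro exI[of _ p]) (auto simp: S_def)
qed

end

theorem theorem3:
  fixes M :: "'a pair_pre_digraph"
  assumes "M \<in> minimal_criminals"
  shows "strongly_connected (with_proj M)
    \<and> (\<forall>u \<in> pverts M. anti_satisfaction M u \<in> {1, 2})
    \<and> (\<forall>u v. (u, v) \<in> parcs M \<longrightarrow>
         (\<exists>x. \<forall>w \<in> ({v} \<union> out_nbrs M 1 v) - {x}.
            \<exists>p. pre_digraph.apath (with_proj M) u p w \<and> length p \<in> {1, 2} \<and> (u, v) \<notin> set p))
    \<and> (\<forall>e \<in> parcs M. transitive_triangles M e \<noteq> {} \<or> two_directed_diamonds M e \<noteq> {})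
    \<and> (\<forall>u v. (u, v) \<in> parcs M \<and> card (out_nbrs M 1 u) \<le> card (out_nbrs M 1 v) \<longrightarrow>
         card (out_nbrs M 1 v) - card (out_nbrs M 1 u) + 1 \<le> card (transitive_triangles M (u, v)) \<and>
         card (out_nbrs M 1 v) - card (out_nbrs M 1 u) + 1 \<le> card (two_directed_diamonds M (u, v)))
    \<and> (\<forall>u \<in> pverts M. \<exists>v \<in> in_nbrs M 1 u. anti_satisfaction M v = 1)
    \<and> (\<exists>p. pre_digraph.cycle (with_proj M) p \<and>
         (\<forall>w \<in> fst ` set p \<union> snd ` set p. anti_satisfaction M w = 1))"
proof -
  interpret minimal_criminal M using assms by unfold_locales
  show ?thesis unfolding out_nbrs_1_eq in_nbrs_1_eq
  proof (intro conjI allI ballI impI)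
    show "strongly_connected (with_proj M)" by (rule strongly_connected_M)
    show "anti_satisfaction M u \<in> {1, 2}" if "u \<in> V" for u
      using that by (rule anti_satisfaction_1_or_2)
    show "\<exists>x. \<forall>w \<in> ({v} \<union> E `` {v}) - {x}.
        \<exists>p. apath u p w \<and> length p \<in> {1, 2} \<and> (u, v) \<notin> set p" if "(u, v) \<in> E" for u v
      using that by (rule short_paths_avoiding_arc)
    show "transitive_triangles M e \<noteq> {} \<or> two_directed_diamonds M e \<noteq> {}" if "e \<in> E" for e
      using that triangle_or_diamond by (cases e) auto
    show "card (E `` {v}) - card (E `` {u}) + 1 \<le> card (transitive_triangles M (u, v))"
      if "(u, v) \<in> E \<and> card (E `` {u}) \<le> card (E `` {v})" for u v
      using that triangle_count[of u v] card_transitive_triangles[of u v] by linarith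
    show "card (E `` {v}) - card (E `` {u}) + 1 \<le> card (two_directed_diamonds M (u, v))"
      if "(u, v) \<in> E \<and> card (E `` {u}) \<le> card (E `` {v})" for u v
      using that diamond_count[of u v] by linarith
    show "\<exists>v \<in> {v. (v, u) \<in> E}. anti_satisfaction M v = 1" if "u \<in> V" for u
      using in_nbr_anti_satisfaction_1[OF that] by blast
    show "\<exists>p. cycle p \<and> (\<forall>w \<in> fst ` set p \<union> snd ` set p. anti_satisfaction M w = 1)"
      by (rule anti_satisfaction_1_cycle)
  qed
qed

end
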